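(* Suppose that $\hat{\mathcal{I}}$ commutes with $\mathrm{Ad}_g$ for every $g \in G^\sigma$, that is, \[ \hat{\mathcal{I}}(g P g^{-1}) (x) = g\, \hat{\mathcal{I}} P(x)\, g^{-1} \] for every $x \in \Omega$, every $g \in G^\sigma$, and every collection of data $P=(P_1,\dots,P_m)\in\mathfrak{p}^m$, where $gPg^{-1}=(gP_1g^{-1},\dots,gP_mg^{-1})$. Then $\mathcal{I}$ is $G^\sigma$-equivariant, that is, \[ \mathcal{I} (g \cdot u)(x) = g \cdot \mathcal{I} u(x) \] for every $x \in \Omega$ and every $g \in G^\sigma$ sufficiently close to the identity (i.e. for every $g$ in some neighborhood, possibly depending on $u$, of $e$ in $G^\sigma$).
   Context: Let $G$ be a (finite-dimensional, real) Lie group with identity $e$ and Lie algebra $\mathfrak{g}$, let $\exp:\mathfrak{g}\to G$ be the Lie group exponential, and let $\sigma : G \to G$ be an involutive (smooth) automorphism: $\sigma\neq\mathrm{id}$, $\sigma(\sigma(g))=g$ and $\sigma(gh)=\sigma(g)\sigma(h)$ for all $g,h\in G$. Let $G^\sigma=\{g\in G \mid \sigma(g)=g\}$. Let $d\sigma$ be the differential of $\sigma$ at $e$, and let $\mathfrak{p}=\{Z\in\mathfrak{g}\mid d\sigma(Z)=-Z\}$. Let $G$ act (smoothly) and transitively on a smooth manifold $\mathcal{S}$, written $g\cdot u$, and let $\eta\in\mathcal{S}$ be an element whose stabilizer is $G^\sigma$. Define $F:\mathfrak{p}\to\mathcal{S}$ by $F(P)=\exp(P)\cdot\eta$. It is known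 that $F$ restricts to a diffeomorphism from an open neighborhood $V$ of $0\in\mathfrak{p}$ onto an open neighborhood $U$ of $\eta\in\mathcal{S}$; fix such $V,U$, and let $F^{-1}:U\to V$ denote the inverse of $F|_V$. For $g\in G$ and $Z\in\mathfrak{g}$, $gZg^{-1}$ means $\mathrm{Ad}_gZ=\left.\frac{d}{dt}\right|_{t=0} g\exp(tZ)g^{-1}$; for $g\in G^\sigma$, $\mathrm{Ad}_g$ maps $\mathfrak{p}$ into itself. Let $\Omega\subset\mathbb{R}^d$, $d\ge1$, be a domain with points $x^{(1)},\dots,x^{(m)}\in\Omega$. Let $\hat{\mathcal{I}}$ be an interpolation operator for $\mathfrak{p}$-valued data: to each $P=(P_1,\dots,P_m)\in\mathfrak{p}^m$, viewed as values at $x^{(1)},\dots,x^{(m)}$, it assigns a function $\hat{\mathcal{I}}P:\Omega\to\mathfrak{p}$ with $\hat{\mathcal{I}}P(x^{(i)})=P_i$ for all $i$. Let $u:\Omega\to\mathcal{S}$ be a smooth function with values in $U$ (the domain of $F^{-1}$), and set $u_i=u(x^{(i)})$. The interpolant $\mathcal{I}u:\Omega\to\mathcal{S}$ is defined by \[ \mathcal{I}u(x)=F(\hat{\mathcal{I}}P(x)),\qquad P=(F^{-1}(u_1),\dots,F^{-1}(u_m)). \] It depends only on $u_1,\dots,u_m$. $\mathcal{I}(g\cdot u)$ is the interpolant built in the same way from the data $g\cdot u_1,\dots,g\cdot u_m$, which lie in $U$ for $g$ sufficiently close to $e$. *)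

theory Defs
  imports "HOL-Analysis.Analysis" "HOL-Algebra.Group_Action"
begin

text \<open>A map is \<open>C\<^sup>k\<close> on an open set if it is differentiable with \<open>C\<^sup>k\<^sup>-\<^sup>1\<close> directional derivatives.
  For finite-dimensional domains, the only ones used here, this is the usual notion.\<close>

primrec C_times :: "nat \<Rightarrow> 'a::real_normed_vector set \<Rightarrow> ('a \<Rightarrow> 'b::real_normed_vector) \<Rightarrow> bool" where
  "C_times 0 W f \<longleftrightarrow> continuous_on W f"
| "C_times (Suc k) W f \<longleftrightarrow>
     (\<exists>f'. (\<forall>x\<in>W. (f has_derivative f' x) (at x)) \<and> (\<forall>v. C_times k W (\<lambda>x. f' x v)))"

text \<open>Smoothness on an arbitrary set means local extendability to smooth maps on open sets.  On an
  open set, or on a relatively open subset of a linear subspace, this is ordinary smoothness.\<close>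

definition smooth_on :: "'a::real_normed_vector set \<Rightarrow> ('a \<Rightarrow> 'b::real_normed_vector) \<Rightarrow> bool" where
  "smooth_on A f \<longleftrightarrow>
     (\<forall>x\<in>A. \<exists>N h. open N \<and> x \<in> N \<and> (\<forall>k. C_times k N h) \<and> (\<forall>y\<in>A \<inter> N. h y = f y))"

type_synonym ('a, 'e) chart = "'a set \<times> ('a \<Rightarrow> 'e)"

record ('a, 'e) manifold =
  mtop :: "'a topology"
  atlas :: "('a, 'e) chart set"

text \<open>By Riesz' theorem a normed space is finite-dimensional iff it has the Heine-Borel property, so
  the sort of \<open>'e\<close> below describes exactly the finite-dimensional real normed spaces; the class
  \<open>euclidean_space\<close> would exclude manifolds of dimension 0.  The atlas need not be maximal.\<close>

definition smooth_manifold :: "('a, 'e::{banach, heine_borel}) manifold \<Rightarrow> bool" where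
  "smooth_manifold M \<longleftrightarrow>
     Hausdorff_space (mtop M) \<and> second_countable (mtop M) \<and>
     topspace (mtop M) = (\<Union>(D, x)\<in>atlas M. D) \<and>
     (\<forall>(D, x)\<in>atlas M. openin (mtop M) D \<and> open (x ` D) \<and>
        homeomorphic_map (subtopology (mtop M) D) (top_of_set (x ` D)) x) \<and>
     (\<forall>(D, x)\<in>atlas M. \<forall>(D', y)\<in>atlas M. smooth_on (x ` (D \<inter> D')) (y \<circ> inv_into D x))"

definition smooth_map ::
  "('a, 'e::real_normed_vector) manifold \<Rightarrow> ('b, 'f::real_normed_vector) manifold \<Rightarrow> ('a \<Rightarrow> 'b) \<Rightarrow> bool"
where
  "smooth_map M N f \<longleftrightarrow>
     continuous_map (mtop M) (mtop N) f \<and>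
     (\<forall>(D, x)\<in>atlas M. \<forall>(D', y)\<in>atlas N.
        smooth_on (x ` {p \<in> D. f p \<in> D'}) (y \<circ> f \<circ> inv_into D x))"

definition diffeomorphism ::
  "('a, 'e::real_normed_vector) manifold \<Rightarrow> ('b, 'f::real_normed_vector) manifold \<Rightarrow> ('a \<Rightarrow> 'b) \<Rightarrow> bool"
where
  "diffeomorphism M N f \<longleftrightarrow>
     smooth_map M N f \<and>
     (\<exists>g. smooth_map N M g \<and>
          (\<forall>p\<in>topspace (mtop M). g (f p) = p) \<and> (\<forall>q\<in>topspace (mtop N). f (g q) = q))"

definition prod_manifold :: "('a, 'e) manifold \<Rightarrow> ('b, 'f) manifold \<Rightarrow> ('a \<times> 'b, 'e \<times> 'f) manifold" where
  "prod_manifold M N =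
     \<lparr>mtop = prod_topology (mtop M) (mtop N),
      atlas = {(D \<times> D', map_prod x y) | D x D' y. (D, x) \<in> atlas M \<and> (D', y) \<in> atlas N}\<rparr>"

definition open_submanifold :: "('a, 'e) manifold \<Rightarrow> 'a set \<Rightarrow> ('a, 'e) manifold" where
  "open_submanifold M U =
     \<lparr>mtop = subtopology (mtop M) U, atlas = {(D \<inter> U, x) | D x. (D, x) \<in> atlas M}\<rparr>"

text \<open>The smooth structure that a subset inherits from the surrounding vector space; it is used for
  open sets and for relatively open subsets of a linear subspace.  In the latter case the single
  global chart takes values in the surrounding space, which is what \<open>smooth_on\<close> is designed for.\<close>

definition flat :: "'v::real_normed_vector set \<Rightarrow> ('v, 'v) manifold" where
  "flat W = \<lparr>mtop = top_of_set W, atlas = {(W, id)}\<rparr>"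

definition lie_group :: "'g monoid \<Rightarrow> ('g, 'e::{banach, heine_borel}) manifold \<Rightarrow> bool" where
  "lie_group G M \<longleftrightarrow>
     group G \<and> smooth_manifold M \<and> carrier G = topspace (mtop M) \<and>
     smooth_map (prod_manifold M M) M (\<lambda>(g, h). g \<otimes>\<^bsub>G\<^esub> h) \<and>
     smooth_map M M (\<lambda>g. inv\<^bsub>G\<^esub> g)"

text \<open>The Lie algebra is the tangent space at the identity.  A chart \<open>c\<close> around the identity
  identifies it with the model space \<open>'e\<close>: a tangent vector is given by its coordinates with respect
  to \<open>c\<close>.  The three notions below do not depend on \<open>c\<close> up to the change of coordinates.\<close>

definition one_parameter_subgroup ::
  "'g monoid \<Rightarrow> ('g, 'e::{banach, heine_borel}) manifold \<Rightarrow> (real \<Rightarrow> 'g) \<Rightarrow> bool" where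
  "one_parameter_subgroup G M \<gamma> \<longleftrightarrow>
     smooth_map (flat UNIV) M \<gamma> \<and> (\<forall>s t. \<gamma> (s + t) = \<gamma> s \<otimes>\<^bsub>G\<^esub> \<gamma> t)"

definition lie_exp ::
  "'g monoid \<Rightarrow> ('g, 'e::{banach, heine_borel}) manifold \<Rightarrow> ('g, 'e) chart \<Rightarrow> 'e \<Rightarrow> 'g" where
  "lie_exp G M c Z =
     (THE \<gamma>. one_parameter_subgroup G M \<gamma> \<and> (snd c \<circ> \<gamma> has_vector_derivative Z) (at 0)) 1"

definition Ad ::
  "'g monoid \<Rightarrow> ('g, 'e::{banach, heine_borel}) manifold \<Rightarrow> ('g, 'e) chart \<Rightarrow> 'g \<Rightarrow> 'e \<Rightarrow> 'e" where
  "Ad G M c g Z =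
     vector_derivative (\<lambda>t. snd c (g \<otimes>\<^bsub>G\<^esub> lie_exp G M c (t *\<^sub>R Z) \<otimes>\<^bsub>G\<^esub> inv\<^bsub>G\<^esub> g)) (at 0)"

definition differential_at_one ::
  "'g monoid \<Rightarrow> ('g, 'e::real_normed_vector) chart \<Rightarrow> ('g \<Rightarrow> 'g) \<Rightarrow> 'e \<Rightarrow> 'e" where
  "differential_at_one G c \<sigma> =
     frechet_derivative (snd c \<circ> \<sigma> \<circ> inv_into (fst c) (snd c)) (at (snd c \<one>\<^bsub>G\<^esub>))"

definition involutive_automorphism ::
  "'g monoid \<Rightarrow> ('g, 'e::{banach, heine_borel}) manifold \<Rightarrow> ('g \<Rightarrow> 'g) \<Rightarrow> bool" where
  "involutive_automorphism G M \<sigma> \<longleftrightarrow>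
     smooth_map M M \<sigma> \<and> \<sigma> \<in> hom G G \<and>
     (\<forall>g\<in>carrier G. \<sigma> (\<sigma> g) = g) \<and> (\<exists>g\<in>carrier G. \<sigma> g \<noteq> g)"

definition fixed_subgroup :: "'g monoid \<Rightarrow> ('g \<Rightarrow> 'g) \<Rightarrow> 'g set" where
  "fixed_subgroup G \<sigma> = {g \<in> carrier G. \<sigma> g = g}"

definition minus_eigenspace ::
  "'g monoid \<Rightarrow> ('g, 'e::real_normed_vector) chart \<Rightarrow> ('g \<Rightarrow> 'g) \<Rightarrow> 'e set" where
  "minus_eigenspace G c \<sigma> = {Z. differential_at_one G c \<sigma> Z = - Z}"

definition smooth_transitive_action ::
  "'g monoid \<Rightarrow> ('g, 'e::{banach, heine_borel}) manifold \<Rightarrow>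
   ('s, 'f::{banach, heine_borel}) manifold \<Rightarrow> ('g \<Rightarrow> 's \<Rightarrow> 's) \<Rightarrow> bool" where
  "smooth_transitive_action G M S \<phi> \<longleftrightarrow>
     transitive_action G (topspace (mtop S)) \<phi> \<and>
     smooth_map (prod_manifold M S) S (\<lambda>(g, u). \<phi> g u)"

definition exp_orbit ::
  "'g monoid \<Rightarrow> ('g, 'e::{banach, heine_borel}) manifold \<Rightarrow> ('g, 'e) chart \<Rightarrow>
   ('g \<Rightarrow> 's \<Rightarrow> 's) \<Rightarrow> 's \<Rightarrow> 'e \<Rightarrow> 's" where
  "exp_orbit G M c \<phi> \<eta> P = \<phi> (lie_exp G M c P) \<eta>"

text \<open>Data at the nodes \<open>pts\<close> are indexed by a finite type \<open>'m\<close>.\<close>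

definition interpolation_operator ::
  "'x set \<Rightarrow> ('m::finite \<Rightarrow> 'x) \<Rightarrow> 'e set \<Rightarrow> (('m \<Rightarrow> 'e) \<Rightarrow> 'x \<Rightarrow> 'e) \<Rightarrow> bool" where
  "interpolation_operator \<Omega> pts p I \<longleftrightarrow>
     (\<forall>P. range P \<subseteq> p \<longrightarrow> I P ` \<Omega> \<subseteq> p \<and> (\<forall>i. I P (pts i) = P i))"

definition interpolant ::
  "('e \<Rightarrow> 's) \<Rightarrow> 'e set \<Rightarrow> ('m::finite \<Rightarrow> 'x) \<Rightarrow> (('m \<Rightarrow> 'e) \<Rightarrow> 'x \<Rightarrow> 'e) \<Rightarrow> ('x \<Rightarrow> 's) \<Rightarrow> 'x \<Rightarrow> 's" where
  "interpolant F V pts I u x = F (I (\<lambda>i. the_inv_into V F (u (pts i))) x)"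

end

(* For P in p and g in G^sigma one has F(Ad_g P) = exp(Ad_g P) eta = g exp(P) g^-1 eta = g F(P), so
   that F^-1(g u_i) = Ad_g F^-1(u_i) as soon as Ad_g F^-1(u_i) lies in V, and the hypothesis on the
   interpolation operator gives the claim.  The relation exp(Ad_g P) = g exp(P) g^-1 comes from the
   uniqueness of one-parameter subgroups with a given velocity: gamma(t) delta(t)^-1 has zero
   derivative at 0, hence everywhere.  Their existence on p, and the continuity of g -> Ad_g P at e,
   are both read off from the fact that F is a homeomorphism near 0. *)

theory Submission
  imports Defs
begin

text \<open>\<open>lie_exp\<close> is a definite description and \<open>Ad\<close> is defined
  through it, so neither can be given its usual meaning at \<open>Z\<close> before a one-parameter
  subgroup with velocity \<open>Z\<close> is known to exist and to be unique. Facts about them are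
  therefore stated under \<open>one_param \<gamma> Z\<close> and become available on p. Two notions
  of curve are kept apart: \<open>one_param\<close>, the smooth one that the description asks for,
  and the weaker \<open>hom_curve\<close>, continuous and differentiable at 0. Uniqueness holds
  already for the weaker one, so that g \<gamma>(t) g^-1 and \<sigma>(\<gamma>(t)) can be compared
  with other curves without a proof of their smoothness. The choice of a neighbourhood of e meets a
  circularity: Finv(g F(P)) = Ad_g P would give continuity in g, but it presupposes that Ad_g P lies
  in V, the very thing to be shown. The relation F(t Ad_g P) = g F(t P) for all real t breaks it for
  small P, and a general P is reduced to a small multiple of itself.\<close>

section \<open>Smoothness and differentiability in normed spaces\<close>

lemma C_times_const: "C_times k W (\<lambda>_. a)"
proof (induction k arbitrary: a)
  case (Suc k)
  have "((\<lambda>_. a) has_derivative (\<lambda>_. 0)) (at x)" for x by simp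
  then show ?case using Suc by (auto intro!: exI[of _ "\<lambda>_ _. 0"])
qed simp

text \<open>The derivative of the rescaled map in direction v is the derivative of \<open>f\<close>
  in the fixed direction a v, again composed with the scaling, so the induction closes without a
  general chain rule for C^k maps.\<close>

lemma C_times_compose_scaleR:
  "C_times k W f \<Longrightarrow> C_times k ((\<lambda>x. a *\<^sub>R x) -` W) (\<lambda>x. f (a *\<^sub>R x))"
proof (induction k arbitrary: f)
  case 0
  then show ?case
    by (auto intro!: continuous_on_compose2[of W f] continuous_intros)
next
  case (Suc k)
  then obtain f' where f': "\<And>x. x \<in> W \<Longrightarrow> (f has_derivative f' x) (at x)"
    and C: "\<And>v. C_times k W (\<lambda>x. f' x v)" by auto
  have "((\<lambda>x. f (a *\<^sub>R x)) has_derivative (\<lambda>v. f' (a *\<^sub>R x) (a *\<^sub>R v))) (at x)"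
    if "a *\<^sub>R x \<in> W" for x
    by (rule has_derivative_compose[where g = f and f = "\<lambda>x. a *\<^sub>R x", OF _ f'[OF that]])
       (auto intro!: derivative_eq_intros)
  then show ?case
    using Suc.IH[OF C] by (auto intro!: exI[of _ "\<lambda>x v. f' (a *\<^sub>R x) (a *\<^sub>R v)"])
qed

lemma smooth_on_const: "smooth_on A (\<lambda>_. a)"
  unfolding smooth_on_def using C_times_const by blast

lemma smooth_on_compose_scaleR:
  assumes "smooth_on A f"
  shows "smooth_on ((\<lambda>x. a *\<^sub>R x) -` A) (\<lambda>x. f (a *\<^sub>R x))"
  unfolding smooth_on_def
proof
  fix x assume "x \<in> (\<lambda>x. a *\<^sub>R x) -` A"
  then obtain N h where N: "open N" "a *\<^sub>R x \<in> N" "\<And>k. C_times k N h"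
    "\<And>y. y \<in> A \<inter> N \<Longrightarrow> h y = f y"
    using assms unfolding smooth_on_def by (metis vimageE)
  show "\<exists>N h. open N \<and> x \<in> N \<and> (\<forall>k. C_times k N h) \<and>
      (\<forall>y\<in>(\<lambda>x. a *\<^sub>R x) -` A \<inter> N. h y = f (a *\<^sub>R y))"
  proof (intro exI conjI allI ballI)
    show "open ((\<lambda>x. a *\<^sub>R x) -` N)"
      by (intro open_vimage N continuous_intros)
    show "C_times k ((\<lambda>x. a *\<^sub>R x) -` N) (\<lambda>x. h (a *\<^sub>R x))" for k
      by (rule C_times_compose_scaleR[OF N(3)])
  qed (use N in simp_all)
qed

lemma smooth_on_imp_differentiable:
  assumes "smooth_on A f" "open A" "x \<in> A"
  shows "f differentiable (at x)"
proof -
  obtain N h where N: "open N" "x \<in> N" "\<forall>k. C_times k N h" "\<forall>y\<in>A \<inter> N. h y = f y"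
    using bspec[OF assms(1)[unfolded smooth_on_def] assms(3)] by (elim exE conjE) (rule that)
  from N(3)[rule_format, of 1] N(2) obtain h' where "(h has_derivative h') (at x)" by auto
  then have "(f has_derivative h') (at x)"
    by (rule has_derivative_transform_within_open[of _ _ _ _ "A \<inter> N"]) (use N assms in auto)
  then show ?thesis by (auto simp: differentiable_def)
qed

section \<open>Smooth maps read in charts, including product charts\<close>

lemma smooth_manifold_chart:
  assumes "smooth_manifold M" "(D, x) \<in> atlas M"
  shows "openin (mtop M) D" "inj_on x D" "open (x ` D)"
    and "openin (mtop M) W \<Longrightarrow> W \<subseteq> D \<Longrightarrow> open (x ` W)"
proof -
  have *: "openin (mtop M) D" "open (x ` D)"
    "homeomorphic_map (subtopology (mtop M) D) (top_of_set (x ` D)) x"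
    using assms unfolding smooth_manifold_def by fast+
  then show "openin (mtop M) D" "open (x ` D)" by auto
  have "topspace (subtopology (mtop M) D) = D"
    using openin_subset[OF *(1)] by auto
  then show "inj_on x D"
    using *(3) by (metis homeomorphic_imp_injective_map)
  assume W: "openin (mtop M) W" "W \<subseteq> D"
  then have "openin (subtopology (mtop M) D) W"
    by (metis inf.absorb1 openin_subtopology_Int)
  then have "openin (top_of_set (x ` D)) (x ` W)"
    using *(3) homeomorphic_imp_open_map open_map_def by blast
  then show "open (x ` W)" using *(2) openin_open_eq by blast
qed

lemma smooth_manifold_ex_chart:
  assumes "smooth_manifold M" "p \<in> topspace (mtop M)"
  obtains D x where "(D, x) \<in> atlas M" "p \<in> D"
  using assms unfolding smooth_manifold_def by fastforce

lemma smooth_map_differentiable: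
  assumes M: "smooth_manifold M" and N: "smooth_manifold N" and f: "smooth_map M N f"
    and "(D, x) \<in> atlas M" "p \<in> D" "(D', y) \<in> atlas N" "f p \<in> D'"
  shows "(y \<circ> f \<circ> inv_into D x) differentiable (at (x p))"
proof (rule smooth_on_imp_differentiable)
  show "smooth_on (x ` {p \<in> D. f p \<in> D'}) (y \<circ> f \<circ> inv_into D x)"
    using f assms unfolding smooth_map_def by fast
  have D: "openin (mtop M) D" "openin (mtop N) D'"
    using smooth_manifold_chart M N assms by blast+
  have "openin (mtop M) {p \<in> topspace (mtop M). f p \<in> D'}"
    using f D openin_continuous_map_preimage unfolding smooth_map_def by blast
  then have "openin (mtop M) (D \<inter> {p \<in> topspace (mtop M). f p \<in> D'})" using D by blast
  moreover have "D \<inter> {p \<in> topspace (mtop M). f p \<in> D'} = {p \<in> D. f p \<in> D'}"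
    using openin_subset[OF D(1)] by auto
  ultimately show "open (x ` {p \<in> D. f p \<in> D'})"
    using smooth_manifold_chart(4)[OF M] assms by auto
  show "x p \<in> x ` {p \<in> D. f p \<in> D'}"
    using \<open>p \<in> D\<close> \<open>f p \<in> D'\<close> by blast
qed

text \<open>The two inverse charts are written separately, so that one argument can be frozen or a
  pair of curves inserted.\<close>

lemma smooth_map_prod_differentiable:
  assumes M: "smooth_manifold M" and N: "smooth_manifold N" and K: "smooth_manifold K"
    and f: "smooth_map (prod_manifold M N) K f"
    and x: "(D, x) \<in> atlas M" "p \<in> D" and y: "(E, y) \<in> atlas N" "q \<in> E"
    and z: "(D', z) \<in> atlas K" "f (p, q) \<in> D'"
  shows "(\<lambda>w. z (f (inv_into D x (fst w), inv_into E y (snd w)))) differentiable (at (x p, y q))"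
proof -
  let ?A = "{w \<in> D \<times> E. f w \<in> D'}" and ?xy = "map_prod x y"
  note cx = smooth_manifold_chart[OF M x(1)] and cy = smooth_manifold_chart[OF N y(1)]
  have "openin (prod_topology (mtop M) (mtop N)) (D \<times> E)"
    using cx(1) cy(1) by (simp add: openin_prod_Times_iff)
  moreover have "openin (prod_topology (mtop M) (mtop N))
      {w \<in> topspace (prod_topology (mtop M) (mtop N)). f w \<in> D'}"
    by (rule openin_continuous_map_preimage[OF _ smooth_manifold_chart(1)[OF K z(1)]])
       (use f in \<open>simp add: smooth_map_def prod_manifold_def\<close>)
  ultimately have "openin (prod_topology (mtop M) (mtop N))
      (D \<times> E \<inter> {w \<in> topspace (prod_topology (mtop M) (mtop N)). f w \<in> D'})" by blast
  moreover have "D \<times> E \<inter> {w \<in> topspace (prod_topology (mtop M) (mtop N)). f w \<in> D'} = ?A"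
    using openin_subset[OF cx(1)] openin_subset[OF cy(1)] by auto
  ultimately have opA: "openin (prod_topology (mtop M) (mtop N)) ?A" by simp
  \<comment> \<open>\<open>smooth_manifold_chart\<close> is available for the factors, so openness
    is checked on boxes, which the product chart maps to boxes of open sets.\<close>
  have "open (?xy ` ?A)"
    unfolding open_prod_def
  proof
    fix w assume "w \<in> ?xy ` ?A"
    then obtain v where "v \<in> ?A" and v: "w = ?xy v" by (rule imageE)
    then obtain a b where ab: "a \<in> D" "b \<in> E" "f (a, b) \<in> D'" and w: "w = ?xy (a, b)"
      by (cases v) auto
    then obtain A B where AB: "openin (mtop M) A" "openin (mtop N) B" "a \<in> A" "b \<in> B"
      "A \<times> B \<subseteq> ?A"
      using opA[unfolded openin_prod_topology_alt, rule_format, of a b] by auto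
    then have "A \<subseteq> D" "B \<subseteq> E" by auto
    then have "open (x ` A)" "open (y ` B)" using cx cy AB by auto
    moreover have "x ` A \<times> y ` B \<subseteq> ?xy ` ?A" using AB(5) by force
    ultimately show "\<exists>A B. open A \<and> open B \<and> w \<in> A \<times> B \<and> A \<times> B \<subseteq> ?xy ` ?A"
      using AB w by (intro exI[of _ "x ` A"] exI[of _ "y ` B"]) auto
  qed
  moreover have "smooth_on (?xy ` ?A) (z \<circ> f \<circ> inv_into (D \<times> E) ?xy)"
  proof -
    have "(D \<times> E, ?xy) \<in> atlas (prod_manifold M N)"
      using x y unfolding prod_manifold_def by auto
    then show ?thesis using f z unfolding smooth_map_def by fast
  qed
  ultimately have "(z \<circ> f \<circ> inv_into (D \<times> E) ?xy) differentiable (at (?xy (p, q)))"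
    using smooth_on_imp_differentiable x y z by blast
  then obtain d where d: "((z \<circ> f \<circ> inv_into (D \<times> E) ?xy) has_derivative d) (at (x p, y q))"
    by (auto simp: differentiable_def)
  \<comment> \<open>The inverse of the product chart splits into the inverses of the factors only
    over the image of the chart; elsewhere \<open>inv_into\<close> is arbitrary. That image is open,
    so the derivative is unaffected.\<close>
  have "inv_into (D \<times> E) ?xy w = (inv_into D x (fst w), inv_into E y (snd w))"
    if w: "w \<in> x ` D \<times> y ` E" for w
  proof -
    have "?xy (inv_into D x (fst w), inv_into E y (snd w)) = w"
      using w by (auto simp: f_inv_into_f)
    moreover have "(inv_into D x (fst w), inv_into E y (snd w)) \<in> D \<times> E"
      using w by (auto intro: inv_into_into)
    ultimately show ?thesis
      using map_prod_inj_on[OF cx(2) cy(2)] inv_into_f_f by metis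
  qed
  then have "((\<lambda>w. z (f (inv_into D x (fst w), inv_into E y (snd w)))) has_derivative d) (at (x p, y q))"
    by (intro has_derivative_transform_within_open[OF d, of "x ` D \<times> y ` E"])
       (use cx cy x y in \<open>auto intro: open_Times\<close>)
  then show ?thesis by (auto simp: differentiable_def)
qed

section \<open>Lie groups: translations and homomorphisms from the real line\<close>

text \<open>Asks for just enough regularity to make a homomorphism unique for its velocity, and is
  visibly stable under conjugation and under \<sigma>.\<close>

definition hom_curve ::
  "'g monoid \<Rightarrow> ('g, 'e::{banach, heine_borel}) manifold \<Rightarrow> ('g, 'e) chart \<Rightarrow> (real \<Rightarrow> 'g) \<Rightarrow> 'e \<Rightarrow> bool"
where
  "hom_curve G M c \<gamma> Z \<longleftrightarrow>
     continuous_map euclideanreal (mtop M) \<gamma> \<and> (\<forall>s t. \<gamma> (s + t) = \<gamma> s \<otimes>\<^bsub>G\<^esub> \<gamma> t) \<and>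
     (snd c \<circ> \<gamma> has_vector_derivative Z) (at 0)"

locale lie_group_chart = group G for G :: "'g monoid" (structure) +
  fixes M :: "('g, 'e::{banach, heine_borel}) manifold" and D :: "'g set" and x :: "'g \<Rightarrow> 'e"
  assumes lie: "lie_group G M" and chart: "(D, x) \<in> atlas M" and one_D: "\<one> \<in> D"
begin

lemma manifold: "smooth_manifold M"
  and carrier_eq: "carrier G = topspace (mtop M)"
  and mult_smooth: "smooth_map (prod_manifold M M) M (\<lambda>(g, h). g \<otimes> h)"
  using lie unfolding lie_group_def by simp_all

lemma continuous_map_mult:
  assumes "continuous_map X (mtop M) f" "continuous_map X (mtop M) g"
  shows "continuous_map X (mtop M) (\<lambda>t. f t \<otimes> g t)"
proof -
  have "continuous_map (prod_topology (mtop M) (mtop M)) (mtop M) (\<lambda>(g, h). g \<otimes> h)"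
    using mult_smooth unfolding smooth_map_def prod_manifold_def by simp
  moreover have "continuous_map X (prod_topology (mtop M) (mtop M)) (\<lambda>t. (f t, g t))"
    using assms by (simp add: continuous_map_pairedI)
  ultimately have "continuous_map X (mtop M) ((\<lambda>(g, h). g \<otimes> h) \<circ> (\<lambda>t. (f t, g t)))"
    using continuous_map_compose by blast
  then show ?thesis by (simp add: o_def)
qed

text \<open>Freeze one argument of the jointly differentiable multiplication at the coordinate of
  \<open>a\<close> in a chart around \<open>a\<close>.\<close>

lemma translation_differentiable:
  assumes y: "(D', y) \<in> atlas M" "h \<in> D'" and z: "(E, z) \<in> atlas M" and a: "a \<in> carrier G"
  shows "a \<otimes> h \<in> E \<Longrightarrow> (\<lambda>w. z (a \<otimes> inv_into D' y w)) differentiable (at (y h))"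
    and "h \<otimes> a \<in> E \<Longrightarrow> (\<lambda>w. z (inv_into D' y w \<otimes> a)) differentiable (at (y h))"
proof -
  obtain A \<alpha> where A: "(A, \<alpha>) \<in> atlas M" "a \<in> A"
    using smooth_manifold_ex_chart manifold a carrier_eq by metis
  have inv: "inv_into A \<alpha> (\<alpha> a) = a"
    using smooth_manifold_chart(2)[OF manifold A(1)] A(2) by simp
  show "(\<lambda>w. z (a \<otimes> inv_into D' y w)) differentiable (at (y h))" if "a \<otimes> h \<in> E"
  proof -
    have 1: "(\<lambda>w. z (case (inv_into A \<alpha> (fst w), inv_into D' y (snd w)) of (g, h) \<Rightarrow> g \<otimes> h))
        differentiable (at (\<alpha> a, y h))"
      using smooth_map_prod_differentiable[OF manifold manifold manifold mult_smooth A y z] that by auto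
    have "(\<lambda>w. (\<alpha> a, w)) differentiable (at (y h))"
      unfolding differentiable_def by (auto intro!: exI derivative_intros)
    then have "((\<lambda>w. z (case (inv_into A \<alpha> (fst w), inv_into D' y (snd w)) of (g, h) \<Rightarrow> g \<otimes> h)) \<circ> (\<lambda>w. (\<alpha> a, w)))
        differentiable (at (y h))"
      using 1 differentiable_chain_at by blast
    then show ?thesis by (simp add: o_def inv)
  qed
  show "(\<lambda>w. z (inv_into D' y w \<otimes> a)) differentiable (at (y h))" if "h \<otimes> a \<in> E"
  proof -
    have 1: "(\<lambda>w. z (case (inv_into D' y (fst w), inv_into A \<alpha> (snd w)) of (g, h) \<Rightarrow> g \<otimes> h))
        differentiable (at (y h, \<alpha> a))"
      using smooth_map_prod_differentiable[OF manifold manifold manifold mult_smooth y A z] that by auto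
    have "(\<lambda>w. (w, \<alpha> a)) differentiable (at (y h))"
      unfolding differentiable_def by (auto intro!: exI derivative_intros)
    then have "((\<lambda>w. z (case (inv_into D' y (fst w), inv_into A \<alpha> (snd w)) of (g, h) \<Rightarrow> g \<otimes> h)) \<circ> (\<lambda>w. (w, \<alpha> a)))
        differentiable (at (y h))"
      using 1 differentiable_chain_at by blast
    then show ?thesis by (simp add: o_def inv)
  qed
qed

text \<open>Only the end point a b is known to lie in \<open>D\<close>; the intermediate point
  \<open>a\<close> may lie outside, so the two translations are composed through another chart
  around \<open>a\<close>.\<close>

lemma two_sided_translation_differentiable:
  assumes a: "a \<in> carrier G" and b: "b \<in> carrier G" and ab: "a \<otimes> b \<in> D"
  shows "(\<lambda>w. x (a \<otimes> inv_into D x w \<otimes> b)) differentiable (at (x \<one>))"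
proof -
  obtain A \<alpha> where A: "(A, \<alpha>) \<in> atlas M" "a \<in> A"
    using smooth_manifold_ex_chart manifold a carrier_eq by metis
  note cA = smooth_manifold_chart[OF manifold A(1)] and cD = smooth_manifold_chart[OF manifold chart]
  have "(\<lambda>w. \<alpha> (a \<otimes> inv_into D x w)) differentiable (at (x \<one>))"
    using translation_differentiable(1)[OF chart one_D A(1) a] A(2) a by simp
  moreover have "(\<lambda>w. x (inv_into A \<alpha> w \<otimes> b)) differentiable (at (\<alpha> (a \<otimes> inv_into D x (x \<one>))))"
    using translation_differentiable(2)[OF A chart b] ab a cD(2) one_D by simp
  ultimately have "((\<lambda>w. x (inv_into A \<alpha> w \<otimes> b)) \<circ> (\<lambda>w. \<alpha> (a \<otimes> inv_into D x w))) differentiable (at (x \<one>))"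
    using differentiable_chain_at by blast
  then obtain d where d: "((\<lambda>w. x (inv_into A \<alpha> (\<alpha> (a \<otimes> inv_into D x w)) \<otimes> b)) has_derivative d) (at (x \<one>))"
    by (auto simp: o_def differentiable_def)
  \<comment> \<open>On this neighbourhood of the identity the detour through the chart \<alpha>
    cancels.\<close>
  let ?W = "{h \<in> topspace (mtop M). a \<otimes> h \<in> A} \<inter> D"
  have "continuous_map (mtop M) (mtop M) (\<lambda>h. a \<otimes> h)"
    by (rule continuous_map_mult) (use a carrier_eq in auto)
  then have "openin (mtop M) ?W"
    using cA(1) cD(1) openin_continuous_map_preimage by blast
  then have "open (x ` ?W)" using cD(4) by blast
  moreover have "x \<one> \<in> x ` ?W"
    using one_D a A(2) one_closed carrier_eq by (intro imageI) auto
  ultimately have "((\<lambda>w. x (a \<otimes> inv_into D x w \<otimes> b)) has_derivative d) (at (x \<one>))"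
    by (intro has_derivative_transform_within_open[OF d, of "x ` ?W"]) (auto simp: cD(2) cA(2))
  then show ?thesis by (auto simp: differentiable_def)
qed

abbreviation curve :: "(real \<Rightarrow> 'g) \<Rightarrow> 'e \<Rightarrow> bool" where
  "curve \<equiv> hom_curve G M (D, x)"

lemma curve_carrier: "curve \<gamma> Z \<Longrightarrow> \<gamma> t \<in> carrier G"
  unfolding hom_curve_def carrier_eq by (auto simp: continuous_map_def)

lemma curve_add: "curve \<gamma> Z \<Longrightarrow> \<gamma> (s + t) = \<gamma> s \<otimes> \<gamma> t"
  unfolding hom_curve_def by blast

lemma curve_zero: "curve \<gamma> Z \<Longrightarrow> \<gamma> 0 = \<one>"
  using curve_add[of \<gamma> Z 0 0] curve_carrier[of \<gamma> Z 0] by simp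

lemma curve_deriv: "curve \<gamma> Z \<Longrightarrow> ((\<lambda>t. x (\<gamma> t)) has_vector_derivative Z) (at 0)"
  unfolding hom_curve_def by (simp add: o_def)

lemma curve_scale:
  assumes "curve \<gamma> Z"
  shows "curve (\<lambda>t. \<gamma> (a * t)) (a *\<^sub>R Z)"
proof -
  have "continuous_map euclideanreal euclideanreal (\<lambda>t. a * t)"
    by (auto intro!: continuous_intros)
  then have "continuous_map euclideanreal (mtop M) (\<gamma> \<circ> (\<lambda>t. a * t))"
    using assms continuous_map_compose unfolding hom_curve_def by blast
  moreover have "((\<lambda>t. x (\<gamma> t)) \<circ> (\<lambda>t. a * t) has_vector_derivative a *\<^sub>R Z) (at 0)"
    by (rule vector_diff_chain_at) (use curve_deriv[OF assms] in \<open>auto intro!: derivative_eq_intros\<close>)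
  ultimately show ?thesis
    using curve_add[OF assms] unfolding hom_curve_def by (simp add: o_def distrib_left)
qed

lemma curve_eventually_D:
  assumes "continuous_map euclideanreal (mtop M) f" "f 0 \<in> D"
  obtains e where "e > 0" "\<And>t. \<bar>t\<bar> < e \<Longrightarrow> f t \<in> D"
proof -
  have "openin euclideanreal {t \<in> topspace euclideanreal. f t \<in> D}"
    using assms(1) smooth_manifold_chart(1)[OF manifold chart] openin_continuous_map_preimage by blast
  then have "open {t. f t \<in> D}" by simp
  then obtain e where "e > 0" "ball 0 e \<subseteq> {t. f t \<in> D}"
    using assms(2) openE by blast
  then show ?thesis using that by (force simp: ball_def dist_real_def)
qed

text \<open>The chain rule in the chart, valid because \<gamma> stays in \<open>D\<close> near 0. It
  is applied with \<open>K\<close> a conjugation and with \<open>K\<close> the involution.\<close>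

lemma curve_compose_differentiable:
  assumes c: "curve \<gamma> Z" and d: "((\<lambda>w. x (K (inv_into D x w))) has_derivative K') (at (x \<one>))"
  shows "((\<lambda>t. x (K (\<gamma> t))) has_vector_derivative K' Z) (at 0)"
proof -
  obtain e where e: "e > 0" "\<And>t. \<bar>t\<bar> < e \<Longrightarrow> \<gamma> t \<in> D"
    using curve_eventually_D[of \<gamma>] c curve_zero[OF c] one_D unfolding hom_curve_def by metis
  have K'lin: "linear K'" using d has_derivative_linear by blast
  have "((\<lambda>t. x (\<gamma> t)) has_derivative (\<lambda>s. s *\<^sub>R Z)) (at 0)"
    using curve_deriv[OF c] by (simp add: has_vector_derivative_def)
  then have "((\<lambda>t. x (K (inv_into D x (x (\<gamma> t))))) has_derivative (\<lambda>s. K' (s *\<^sub>R Z))) (at 0)"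
    by (rule has_derivative_compose) (use d curve_zero[OF c] in simp)
  then have "((\<lambda>t. x (K (\<gamma> t))) has_derivative (\<lambda>s. K' (s *\<^sub>R Z))) (at 0)"
    by (rule has_derivative_transform_within_open[of _ _ _ _ "ball 0 e"])
       (use e smooth_manifold_chart(2)[OF manifold chart] in auto)
  then show ?thesis by (simp add: has_vector_derivative_def linear_scale[OF K'lin])
qed

text \<open>The derivative of the multiplication vanishes on \<open>(Z, - Z)\<close> because the product
  \<open>\<gamma> t \<otimes> \<gamma> (- t)\<close> is constant; only \<open>Z\<close> enters, so the same holds for two curves.\<close>

lemma curve_quotient_deriv_zero:
  assumes c: "curve \<gamma> Z" and d: "curve \<delta> Z"
  shows "((\<lambda>t. x (\<gamma> t \<otimes> \<delta> (- t))) has_vector_derivative 0) (at 0)"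
proof -
  let ?m = "\<lambda>w. x (case (inv_into D x (fst w), inv_into D x (snd w)) of (g, h) \<Rightarrow> g \<otimes> h)"
  have "?m differentiable (at (x \<one>, x \<one>))"
    using smooth_map_prod_differentiable[OF manifold manifold manifold mult_smooth
      chart one_D chart one_D chart] one_D by auto
  then obtain m' where m': "(?m has_derivative m') (at (x \<one>, x \<one>))"
    by (auto simp: differentiable_def)
  have *: "((\<lambda>t. x (\<alpha> t \<otimes> \<beta> (- t))) has_derivative (\<lambda>s. m' (s *\<^sub>R Z, s *\<^sub>R (- Z)))) (at 0)"
    if a: "curve \<alpha> Z" and b: "curve \<beta> Z" for \<alpha> \<beta>
  proof -
    have b': "curve (\<lambda>t. \<beta> (- t)) (- Z)" using curve_scale[OF b, of "- 1"] by simp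
    obtain e where e: "e > 0" "\<And>t. \<bar>t\<bar> < e \<Longrightarrow> \<alpha> t \<in> D"
      using curve_eventually_D[of \<alpha>] a curve_zero[OF a] one_D unfolding hom_curve_def by metis
    obtain e' where e': "e' > 0" "\<And>t. \<bar>t\<bar> < e' \<Longrightarrow> \<beta> (- t) \<in> D"
      using curve_eventually_D[of "\<lambda>t. \<beta> (- t)"] b' curve_zero[OF b] one_D
      unfolding hom_curve_def by (metis minus_zero)
    have "((\<lambda>t. (x (\<alpha> t), x (\<beta> (- t)))) has_derivative (\<lambda>s. (s *\<^sub>R Z, s *\<^sub>R (- Z)))) (at 0)"
      using curve_deriv[OF a] curve_deriv[OF b'] unfolding has_vector_derivative_def
      by (intro has_derivative_Pair)
    then have "((\<lambda>t. ?m (x (\<alpha> t), x (\<beta> (- t)))) has_derivative (\<lambda>s. m' (s *\<^sub>R Z, s *\<^sub>R (- Z)))) (at 0)"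
      by (rule has_derivative_compose) (use m' curve_zero[OF a] curve_zero[OF b] in simp)
    then show ?thesis
      by (rule has_derivative_transform_within_open[of _ _ _ _ "ball 0 (min e e')"])
         (use e e' smooth_manifold_chart(2)[OF manifold chart] in auto)
  qed
  have "\<gamma> t \<otimes> \<gamma> (- t) = \<one>" for t
    using curve_add[OF c, of t "- t"] curve_zero[OF c] by simp
  then have "((\<lambda>t. x (\<gamma> t \<otimes> \<gamma> (- t))) has_derivative (\<lambda>_. 0)) (at 0)" by simp
  then have "(\<lambda>s. m' (s *\<^sub>R Z, s *\<^sub>R (- Z))) = (\<lambda>_. 0)"
    using *[OF c c] has_derivative_unique by blast
  then show ?thesis using *[OF c d] by (simp add: has_vector_derivative_def)
qed

text \<open>For f(t) = \<gamma>(t) \<delta>(-t) one has f(t + s) = \<gamma>(t) f(s) \<delta>(-t), so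
  a two-sided translation carries the zero derivative at 0 to t. The chart limits this to an
  interval around 0; the homomorphism property then reaches the whole line.\<close>

lemma curve_unique:
  assumes c: "curve \<gamma> Z" and d: "curve \<delta> Z"
  shows "\<gamma> = \<delta>"
proof -
  note [simp] = curve_carrier[OF c] curve_carrier[OF d]
  have d': "curve (\<lambda>t. \<delta> (- t)) (- Z)" using curve_scale[OF d, of "- 1"] by simp
  let ?f = "\<lambda>t. \<gamma> t \<otimes> \<delta> (- t)"
  have f0: "?f 0 = \<one>" using curve_zero[OF c] curve_zero[OF d] by simp
  have "continuous_map euclideanreal (mtop M) ?f"
    using c d' unfolding hom_curve_def by (intro continuous_map_mult) auto
  then obtain e where e: "e > 0" "\<And>t. \<bar>t\<bar> < e \<Longrightarrow> ?f t \<in> D"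
    using curve_eventually_D[of ?f] f0 one_D by metis
  note inj = smooth_manifold_chart(2)[OF manifold chart]
  have deriv: "((\<lambda>s. x (?f s)) has_vector_derivative 0) (at t)" if t: "\<bar>t\<bar> < e" for t
  proof -
    \<comment> \<open>The translation is differentiable in the single chart \<open>D\<close> because
      it takes the identity to f(t), which lies in \<open>D\<close> for t in the interval.\<close>
    obtain T where T: "((\<lambda>w. x (\<gamma> t \<otimes> inv_into D x w \<otimes> \<delta> (- t))) has_derivative T) (at (x \<one>))"
      using two_sided_translation_differentiable[of "\<gamma> t" "\<delta> (- t)"] e(2)[OF t]
      by (auto simp: differentiable_def)
    have "((\<lambda>s. x (?f s)) has_derivative (\<lambda>_. 0)) (at 0)"
      using curve_quotient_deriv_zero[OF c d] by (simp add: has_vector_derivative_def)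
    then have "((\<lambda>s. x (\<gamma> t \<otimes> inv_into D x (x (?f s)) \<otimes> \<delta> (- t))) has_derivative (\<lambda>_. T 0)) (at 0)"
      by (rule has_derivative_compose) (use T f0 in simp)
    then have "((\<lambda>s. x (?f (t + s))) has_derivative (\<lambda>_. T 0)) (at 0)"
    proof (rule has_derivative_transform_within_open[of _ _ _ _ "ball 0 e"])
      fix s :: real assume "s \<in> ball 0 e"
      then have "?f s \<in> D" using e by simp
      moreover have "\<gamma> t \<otimes> ?f s \<otimes> \<delta> (- t) = ?f (t + s)"
        using curve_add[OF c, of t s] curve_add[OF d, of "- s" "- t"]
        by (simp add: m_assoc add.commute)
      ultimately show "x (\<gamma> t \<otimes> inv_into D x (x (?f s)) \<otimes> \<delta> (- t)) = x (?f (t + s))"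
        using inj by simp
    qed (use e in auto)
    moreover have "T 0 = 0" using T has_derivative_linear linear_0 by blast
    ultimately have "((\<lambda>s. x (?f (t + s))) has_derivative (\<lambda>_. 0)) (at (t - t))" by simp
    moreover have "((\<lambda>s. s - t) has_derivative (\<lambda>s. s)) (at t)"
      by (auto intro!: derivative_eq_intros)
    ultimately have "((\<lambda>s. x (?f (t + (s - t)))) has_derivative (\<lambda>_. 0)) (at t)"
      using has_derivative_compose[where f = "\<lambda>s. s - t" and g = "\<lambda>s. x (?f (t + s))"] by blast
    then show ?thesis by (simp add: has_vector_derivative_def)
  qed
  have local: "\<gamma> t = \<delta> t" if t: "\<bar>t\<bar> < e" for t
  proof -
    have "((\<lambda>s. x (?f s)) has_vector_derivative 0) (at s within ball 0 e)" if "s \<in> ball 0 e" for s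
      using deriv[of s] that by (simp add: has_vector_derivative_at_within)
    then obtain k where "\<And>s. s \<in> ball 0 e \<Longrightarrow> x (?f s) = k"
      using has_vector_derivative_zero_constant[OF convex_ball] by blast
    then have "x (?f t) = x (?f 0)" using t e(1) by (metis centre_in_ball mem_ball_0 real_norm_def)
    then have "?f t = \<one>" using inj f0 e(2)[OF t] one_D by (metis inj_onD)
    moreover have "\<delta> t \<otimes> \<delta> (- t) = \<one>"
      using curve_add[OF d, of t "- t"] curve_zero[OF d] by simp
    \<comment> \<open>Both \<gamma>(t) and \<delta>(t) are left inverses of \<delta>(-t).\<close>
    ultimately show ?thesis by (metis curve_carrier[OF c] curve_carrier[OF d] inv_equality)
  qed
  \<comment> \<open>Every t is n times a point t/n of the interval, and both curves are determined
    at t by the n-th power of their value at t/n.\<close>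
  have pow: "\<alpha> (real n * s) = \<alpha> s [^] n" if a: "curve \<alpha> Z" for \<alpha> n s
  proof (induction n)
    case (Suc n)
    then show ?case using curve_add[OF a, of "real n * s" s] by (simp add: distrib_right add.commute)
  qed (use curve_zero[OF a] in simp)
  show ?thesis
  proof
    fix t
    obtain n where n: "\<bar>t\<bar> / e < real n" using reals_Archimedean2 by blast
    then have n0: "real n > 0" using e(1) by (smt (verit) divide_nonneg_pos)
    then have "\<bar>t / real n\<bar> < e" using n e(1) by (simp add: field_simps)
    then have "\<gamma> (t / real n) = \<delta> (t / real n)" by (rule local)
    then show "\<gamma> t = \<delta> t" using pow[OF c, of n "t / real n"] pow[OF d, of n "t / real n"] n0 by simp
  qed
qed

section \<open>One-parameter subgroups and the exponential\<close>

text \<open>The predicate inside the description in \<open>lie_exp\<close>, with the unreduced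
  \<open>snd (D, x)\<close> so that it matches literally.\<close>

abbreviation one_param :: "(real \<Rightarrow> 'g) \<Rightarrow> 'e \<Rightarrow> bool" where
  "one_param \<gamma> Z \<equiv>
     one_parameter_subgroup G M \<gamma> \<and> (snd (D, x) \<circ> \<gamma> has_vector_derivative Z) (at 0)"

lemma one_param_curve: "one_param \<gamma> Z \<Longrightarrow> curve \<gamma> Z"
  unfolding one_parameter_subgroup_def hom_curve_def smooth_map_def flat_def by simp

lemma smooth_map_real_iff:
  "smooth_map (flat UNIV) M \<gamma> \<longleftrightarrow> continuous_map euclideanreal (mtop M) \<gamma> \<and>
     (\<forall>(D', y)\<in>atlas M. smooth_on (\<gamma> -` D') (\<lambda>t. y (\<gamma> t)))"
  unfolding smooth_map_def flat_def by (simp add: vimage_def o_def inv_id[unfolded id_def] id_def)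

lemma one_param_scale:
  assumes "one_param \<gamma> Z"
  shows "one_param (\<lambda>t. \<gamma> (a * t)) (a *\<^sub>R Z)"
proof -
  have c: "curve (\<lambda>t. \<gamma> (a * t)) (a *\<^sub>R Z)"
    using assms one_param_curve curve_scale by blast
  have "smooth_on ((\<lambda>t. \<gamma> (a * t)) -` D') (\<lambda>t. y (\<gamma> (a * t)))" if "(D', y) \<in> atlas M" for D' y
  proof -
    have "smooth_on (\<gamma> -` D') (\<lambda>t. y (\<gamma> t))"
      using assms that unfolding one_parameter_subgroup_def smooth_map_real_iff by auto
    from smooth_on_compose_scaleR[OF this, of a] show ?thesis by (simp add: vimage_def)
  qed
  then show ?thesis
    using c unfolding one_parameter_subgroup_def smooth_map_real_iff hom_curve_def by auto
qed

lemma one_param_zero: "one_param (\<lambda>_. \<one>) 0"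
  unfolding one_parameter_subgroup_def smooth_map_real_iff
  using smooth_on_const one_closed by (auto simp: carrier_eq[symmetric] o_def)

lemma lie_exp_eq:
  assumes "one_param \<gamma> Z"
  shows "lie_exp G M (D, x) Z = \<gamma> 1"
  unfolding lie_exp_def
  by (subst the_equality[of _ \<gamma>]) (use assms one_param_curve curve_unique in blast)+

lemma lie_exp_scale:
  assumes "one_param \<gamma> Z"
  shows "lie_exp G M (D, x) (a *\<^sub>R Z) = \<gamma> a"
  using lie_exp_eq[OF one_param_scale[OF assms]] by simp

section \<open>Conjugation and the adjoint action\<close>

text \<open>The adjoint map as a derivative in the chart: for g in the group it is linear on the
  whole model space, whereas \<open>Ad\<close> is identified with it only at velocities of
  one-parameter subgroups.\<close>

definition conj_deriv :: "'g \<Rightarrow> 'e \<Rightarrow> 'e" where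
  "conj_deriv g = frechet_derivative (\<lambda>w. x (g \<otimes> inv_into D x w \<otimes> inv g)) (at (x \<one>))"

lemma conj_has_derivative:
  assumes "g \<in> carrier G"
  shows "((\<lambda>w. x (g \<otimes> inv_into D x w \<otimes> inv g)) has_derivative conj_deriv g) (at (x \<one>))"
  unfolding conj_deriv_def
  using two_sided_translation_differentiable[of g "inv g"] assms one_D
  by (simp add: frechet_derivative_works[symmetric])

lemma Ad_eq:
  assumes "one_param \<gamma> Z" "g \<in> carrier G"
  shows "Ad G M (D, x) g Z = conj_deriv g Z"
  using curve_compose_differentiable[OF one_param_curve[OF assms(1)], of "\<lambda>h. g \<otimes> h \<otimes> inv g",
    OF conj_has_derivative[OF assms(2)]]
  unfolding Ad_def by (simp add: lie_exp_scale[OF assms(1)] vector_derivative_at)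

lemma curve_conj:
  assumes c: "curve \<gamma> Z" and g: "g \<in> carrier G"
  shows "curve (\<lambda>t. g \<otimes> \<gamma> t \<otimes> inv g) (conj_deriv g Z)"
  unfolding hom_curve_def
proof (intro conjI allI)
  show "continuous_map euclideanreal (mtop M) (\<lambda>t. g \<otimes> \<gamma> t \<otimes> inv g)"
    using c g inv_closed[OF g] unfolding hom_curve_def
    by (intro continuous_map_mult) (simp_all add: carrier_eq[symmetric])
  show "(snd (D, x) \<circ> (\<lambda>t. g \<otimes> \<gamma> t \<otimes> inv g) has_vector_derivative conj_deriv g Z) (at 0)"
    using curve_compose_differentiable[OF c conj_has_derivative[OF g]] by (simp add: o_def)
  fix s t
  note [simp] = curve_carrier[OF c]
  have "inv g \<otimes> (g \<otimes> y) = y" if "y \<in> carrier G" for y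
    using g that m_assoc[of "inv g" g y] by simp
  then show "g \<otimes> \<gamma> (s + t) \<otimes> inv g = g \<otimes> \<gamma> s \<otimes> inv g \<otimes> (g \<otimes> \<gamma> t \<otimes> inv g)"
    using g by (simp add: curve_add[OF c] m_assoc)
qed

text \<open>The conjugated curve is known only as a \<open>hom_curve\<close>, while
  \<open>lie_exp\<close> asks for a smooth one. Hence \<delta> is assumed, and uniqueness identifies
  it with the conjugate of \<gamma>.\<close>

lemma lie_exp_Ad:
  assumes c: "one_param \<gamma> Z" and d: "one_param \<delta> (Ad G M (D, x) g Z)" and g: "g \<in> carrier G"
  shows "lie_exp G M (D, x) (Ad G M (D, x) g Z) = g \<otimes> lie_exp G M (D, x) Z \<otimes> inv g"
proof -
  have "\<delta> = (\<lambda>t. g \<otimes> \<gamma> t \<otimes> inv g)"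
    using curve_unique[OF one_param_curve[OF d]] curve_conj[OF one_param_curve[OF c] g]
    by (simp add: Ad_eq[OF c g])
  then show ?thesis by (simp add: lie_exp_eq[OF c] lie_exp_eq[OF d])
qed

section \<open>The involution and its (-1)-eigenspace\<close>

lemma involution_has_derivative:
  assumes s: "involutive_automorphism G M \<sigma>"
  shows "((\<lambda>w. x (\<sigma> (inv_into D x w))) has_derivative differential_at_one G (D, x) \<sigma>) (at (x \<one>))"
proof -
  have "\<sigma> \<one> = \<one>"
    using s is_group hom_one unfolding involutive_automorphism_def by blast
  then have "(x \<circ> \<sigma> \<circ> inv_into D x) differentiable (at (x \<one>))"
    using s smooth_map_differentiable[OF manifold manifold _ chart one_D chart, of \<sigma>] one_D
    unfolding involutive_automorphism_def by simp
  then show ?thesis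
    unfolding differential_at_one_def by (simp add: frechet_derivative_works o_def)
qed

text \<open>Uniqueness gives \<sigma>(\<gamma>(t)) = \<gamma>(-t), both curves having velocity -Z.
  As \<sigma> fixes g, it also reverses the conjugated curve, and differentiation at 0 gives the
  claim.\<close>

lemma differential_Ad_fixed:
  assumes s: "involutive_automorphism G M \<sigma>" and c: "one_param \<gamma> Z"
    and Z: "differential_at_one G (D, x) \<sigma> Z = - Z" and g: "g \<in> fixed_subgroup G \<sigma>"
  shows "differential_at_one G (D, x) \<sigma> (Ad G M (D, x) g Z) = - Ad G M (D, x) g Z"
proof -
  have g': "g \<in> carrier G" "\<sigma> g = g" using g unfolding fixed_subgroup_def by auto
  have hom: "\<sigma> \<in> hom G G" and cont: "continuous_map (mtop M) (mtop M) \<sigma>"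
    using s unfolding involutive_automorphism_def smooth_map_def by auto
  interpret \<sigma>: group_hom G G \<sigma> using hom by unfold_locales
  note d = involution_has_derivative[OF s]
  have c': "curve \<gamma> Z" using c by (rule one_param_curve)
  note [simp] = curve_carrier[OF c'] g'(1)
  have "curve (\<lambda>t. \<sigma> (\<gamma> t)) (- Z)"
    using curve_compose_differentiable[OF c' d] c' continuous_map_compose[OF _ cont, of euclideanreal \<gamma>]
    unfolding hom_curve_def by (simp add: Z o_def curve_add[OF c'])
  moreover have "curve (\<lambda>t. \<gamma> (- t)) (- Z)" using curve_scale[OF c', of "- 1"] by simp
  ultimately have flip: "\<sigma> (\<gamma> t) = \<gamma> (- t)" for t by (metis curve_unique)
  let ?\<alpha> = "\<lambda>t. g \<otimes> \<gamma> t \<otimes> inv g" and ?W = "Ad G M (D, x) g Z"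
  have a: "curve ?\<alpha> ?W" using curve_conj[OF c'] Ad_eq[OF c] by simp
  have "((\<lambda>t. x (\<sigma> (?\<alpha> t))) has_vector_derivative differential_at_one G (D, x) \<sigma> ?W) (at 0)"
    by (rule curve_compose_differentiable[OF a d])
  moreover have "\<sigma> (?\<alpha> t) = ?\<alpha> (- t)" for t
    by (simp add: flip g'(2))
  moreover have "((\<lambda>t. x (?\<alpha> (- t))) has_vector_derivative - ?W) (at 0)"
    using curve_deriv[OF curve_scale[OF a, of "- 1"]] by simp
  ultimately show ?thesis using vector_derivative_unique_at by simp
qed

end

section \<open>The homogeneous space and the map \<open>F\<close>\<close>

locale symmetric_space_chart = lie_group_chart G M D x
  for G :: "'g monoid" (structure) and M :: "('g, 'e::{banach, heine_borel}) manifold" and D x +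
  fixes \<sigma> :: "'g \<Rightarrow> 'g" and S :: "('s, 'f::{banach, heine_borel}) manifold"
    and \<phi> :: "'g \<Rightarrow> 's \<Rightarrow> 's" and \<eta> :: 's and V :: "'e set" and U :: "'s set"
  assumes involution: "involutive_automorphism G M \<sigma>"
    and action: "smooth_transitive_action G M S \<phi>"
    and base: "\<eta> \<in> topspace (mtop S)"
    and stabilizer: "stabilizer G \<phi> \<eta> = fixed_subgroup G \<sigma>"
    and V_open: "openin (top_of_set (minus_eigenspace G (D, x) \<sigma>)) V" and V_zero: "0 \<in> V"
    and U_open: "openin (mtop S) U"
    and diffeo: "diffeomorphism (flat V) (open_submanifold S U) (exp_orbit G M (D, x) \<phi> \<eta>)"
begin

abbreviation "p \<equiv> minus_eigenspace G (D, x) \<sigma>"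
abbreviation "K \<equiv> fixed_subgroup G \<sigma>"
abbreviation "F \<equiv> exp_orbit G M (D, x) \<phi> \<eta>"
abbreviation "Finv \<equiv> the_inv_into V F"
abbreviation "A \<equiv> Ad G M (D, x)"

sublocale group_action G "topspace (mtop S)" \<phi>
  using action unfolding smooth_transitive_action_def by (simp add: transitive_action_def)

lemma K_carrier: "g \<in> K \<Longrightarrow> g \<in> carrier G"
  unfolding fixed_subgroup_def by simp

lemma p_scale: "P \<in> p \<Longrightarrow> a *\<^sub>R P \<in> p"
  using linear_scale[OF has_derivative_linear[OF involution_has_derivative[OF involution]]]
  unfolding minus_eigenspace_def by simp

lemma V_subset: "V \<subseteq> p"
  using V_open openin_imp_subset by blast

text \<open>The inverse provided by \<open>diffeomorphism\<close> is exchanged for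
  \<open>the_inv_into V F\<close>, the one that \<open>interpolant\<close> uses; the two agree on
  \<open>U\<close>.\<close>

lemma F_bij: "inj_on F V" "F ` V = U" "continuous_map (top_of_set V) (mtop S) F"
    "continuous_map (subtopology (mtop S) U) euclidean Finv"
proof -
  have U: "topspace (subtopology (mtop S) U) = U" using openin_subset[OF U_open] by auto
  obtain h where c: "continuous_map (top_of_set V) (subtopology (mtop S) U) F"
      "continuous_map (subtopology (mtop S) U) (top_of_set V) h"
    and h: "\<And>P. P \<in> V \<Longrightarrow> h (F P) = P" "\<And>q. q \<in> U \<Longrightarrow> F (h q) = q"
    using diffeo U unfolding diffeomorphism_def smooth_map_def flat_def open_submanifold_def by auto
  show inj: "inj_on F V" using h(1) by (metis inj_onI)
  have "F P \<in> U" if "P \<in> V" for P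
    using continuous_map_image_subset_topspace[OF c(1)] that U by auto
  moreover have hV: "h q \<in> V" if "q \<in> U" for q
    using continuous_map_image_subset_topspace[OF c(2)] that U by auto
  ultimately show "F ` V = U" using h(2) by (force simp: image_iff)
  show "continuous_map (top_of_set V) (mtop S) F"
    using c(1) continuous_map_in_subtopology by blast
  have "Finv q = h q" if "q \<in> U" for q
    using the_inv_into_f_f[OF inj hV[OF that]] h(2)[OF that] by simp
  moreover have "continuous_map (subtopology (mtop S) U) euclidean h"
    using c(2) continuous_map_in_subtopology by blast
  ultimately show "continuous_map (subtopology (mtop S) U) euclidean Finv"
    using continuous_map_eq[of _ _ h Finv] U by metis
qed

text \<open>The factor \<open>c\<close> serves to undo a shrinking of the argument of
  \<open>F\<close>, see \<open>Ad_near_one\<close>.\<close>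

lemma openin_Finv:
  assumes "open T"
  shows "openin (mtop S) {q \<in> U. c *\<^sub>R Finv q \<in> T}"
proof -
  have "continuous_map (subtopology (mtop S) U) euclidean (\<lambda>q. c *\<^sub>R Finv q)"
    using continuous_map_compose[OF F_bij(4), of euclidean "\<lambda>v. c *\<^sub>R v"]
    by (simp add: o_def continuous_on_scaleR)
  then have "openin (subtopology (mtop S) U) {q \<in> topspace (subtopology (mtop S) U). c *\<^sub>R Finv q \<in> T}"
    using assms open_openin by (intro openin_continuous_map_preimage) auto
  then have "openin (mtop S) {q \<in> topspace (subtopology (mtop S) U). c *\<^sub>R Finv q \<in> T}"
    using openin_trans_full[OF _ U_open] by blast
  moreover have "topspace (subtopology (mtop S) U) = U" using openin_subset[OF U_open] by auto
  ultimately show ?thesis by (simp only:)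
qed

lemma ball_subset:
  assumes "openin (top_of_set p) W" "0 \<in> W"
  obtains r where "r > 0" "\<And>P. P \<in> p \<Longrightarrow> norm P < r \<Longrightarrow> P \<in> W"
proof -
  obtain T where "open T" "W = p \<inter> T" using assms(1) openin_open by blast
  moreover obtain r where "r > 0" "ball 0 r \<subseteq> T" using calculation assms(2) openE by blast
  ultimately show ?thesis using that[of r] by (auto simp: subset_iff)
qed

text \<open>No integration of vector fields is needed here: if \<open>P \<noteq> 0\<close> generated no one-parameter
  subgroup, then neither would any nonzero multiple of \<open>P\<close>, so that the definite description in
  \<^const>\<open>lie_exp\<close> would have the same junk value at all of them, contrary to the injectivity of \<open>F\<close>
  near 0.\<close>

lemma one_param_exists:
  assumes P: "P \<in> p"
  shows "\<exists>\<gamma>. one_param \<gamma> P"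
proof (cases "P = 0")
  case True
  then show ?thesis using one_param_zero by blast
next
  case False
  obtain r where r: "r > 0" "\<And>P. P \<in> p \<Longrightarrow> norm P < r \<Longrightarrow> P \<in> V"
    using ball_subset[OF V_open V_zero] by blast
  show ?thesis
  proof (rule ccontr)
    assume none: "\<nexists>\<gamma>. one_param \<gamma> P"
    have "(\<lambda>\<gamma>. one_param \<gamma> (a *\<^sub>R P)) = (\<lambda>_. False)" if "a \<noteq> 0" for a
      using one_param_scale[where a = "1 / a" and Z = "a *\<^sub>R P"] none that by fastforce
    then have junk: "F (a *\<^sub>R P) = \<phi> ((THE _ :: real \<Rightarrow> 'g. False) 1) \<eta>" if "a \<noteq> 0" for a
      using that unfolding exp_orbit_def lie_exp_def by simp
    \<comment> \<open>Puts a P at norm r/2 and its half at norm r/4: two distinct points of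
      \<open>V\<close>.\<close>
    define a where "a = r / (2 * norm P)"
    have a: "a > 0" using r(1) False by (simp add: a_def)
    have "norm (a *\<^sub>R P) < r" "norm ((a / 2) *\<^sub>R P) < r"
      using r(1) False by (simp_all add: a_def)
    then have "a *\<^sub>R P \<in> V" "(a / 2) *\<^sub>R P \<in> V" using r(2) p_scale P by blast+
    moreover have "F (a *\<^sub>R P) = F ((a / 2) *\<^sub>R P)" using junk[of a] junk[of "a / 2"] a by simp
    ultimately have "a *\<^sub>R P = (a / 2) *\<^sub>R P" using F_bij(1) by (metis inj_onD)
    then show False using a False by simp
  qed
qed

lemma lie_exp_carrier: "P \<in> p \<Longrightarrow> lie_exp G M (D, x) P \<in> carrier G"
  by (metis one_param_exists lie_exp_eq one_param_curve curve_carrier)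

lemma F_topspace: "P \<in> p \<Longrightarrow> F P \<in> topspace (mtop S)"
  unfolding exp_orbit_def using element_image[OF lie_exp_carrier base] by blast

lemma Ad_p: "g \<in> K \<Longrightarrow> P \<in> p \<Longrightarrow> A g P \<in> p"
  using one_param_exists[of P] differential_Ad_fixed[OF involution]
  unfolding minus_eigenspace_def by blast

lemma Ad_scale:
  assumes g: "g \<in> carrier G" and P: "P \<in> p"
  shows "A g (a *\<^sub>R P) = a *\<^sub>R A g P"
proof -
  obtain \<gamma> where c: "one_param \<gamma> P" using one_param_exists[OF P] by blast
  have "linear (conj_deriv g)" using conj_has_derivative[OF g] has_derivative_linear by blast
  then show ?thesis by (simp add: Ad_eq[OF c g] Ad_eq[OF one_param_scale[OF c] g] linear_scale)
qed

lemma F_Ad: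
  assumes g: "g \<in> K" and P: "P \<in> p"
  shows "F (A g P) = \<phi> g (F P)"
proof -
  note [simp] = K_carrier[OF g] lie_exp_carrier[OF P]
  have "\<phi> g \<eta> = \<eta>" using g stabilizer unfolding stabilizer_def by blast
  then have "\<phi> (inv g) \<eta> = \<eta>" using orbit_sym_aux base by simp
  moreover obtain \<gamma> \<delta> where "one_param \<gamma> P" "one_param \<delta> (A g P)"
    using one_param_exists P Ad_p g by blast
  ultimately show ?thesis
    unfolding exp_orbit_def using base by (simp add: lie_exp_Ad composition_rule)
qed

section \<open>Continuity of Ad_g P in g at the identity\<close>

text \<open>The proof avoids any estimate of the differential of conjugation: by homogeneity, if
  \<^term>\<open>A g Q\<close> were not in the ball of radius \<open>r / 2\<close>, then some \<^term>\<open>t *\<^sub>R A g Q\<close> with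
  \<open>0 < t \<le> 1\<close> would be on its boundary, hence in \<open>V\<close>, whereas \<open>F\<close> maps it to
  \<^term>\<open>\<phi> g (F (t *\<^sub>R Q))\<close>, which is the image of a point inside the ball.\<close>

lemma Ad_small:
  obtains N r where "openin (mtop M) N" "\<one> \<in> N" "r > 0"
    "\<And>Q. Q \<in> p \<Longrightarrow> norm Q < r \<Longrightarrow> Q \<in> V"
    "\<And>g Q. g \<in> N \<Longrightarrow> g \<in> K \<Longrightarrow> Q \<in> p \<Longrightarrow> norm Q < r \<Longrightarrow> A g Q \<in> V"
proof -
  obtain r where r: "r > 0" "\<And>P. P \<in> p \<Longrightarrow> norm P < r \<Longrightarrow> P \<in> V"
    using ball_subset[OF V_open V_zero] by blast
  \<comment> \<open>Radius r/2 rather than r keeps the boundary sphere, within p, inside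
    \<open>V\<close>, where \<open>F\<close> is injective. The factor 1 gives the set the form of
    \<open>openin_Finv\<close>.\<close>
  let ?W = "{q \<in> U. 1 *\<^sub>R Finv q \<in> ball 0 (r / 2)}"
  let ?Y = "{w \<in> topspace (prod_topology (mtop M) (mtop S)). (\<lambda>(g, u). \<phi> g u) w \<in> ?W}"
  have F0: "F 0 = \<eta>"
    using lie_exp_eq[OF one_param_zero] id_eq_one base unfolding exp_orbit_def
    by (metis restrict_apply')
  have "\<eta> \<in> ?W"
    using imageI[OF V_zero, of F] F_bij(2) the_inv_into_f_f[OF F_bij(1) V_zero] r(1) F0 by simp
  moreover have "\<phi> \<one> \<eta> = \<eta>" using id_eq_one base by (metis restrict_apply')
  moreover have "continuous_map (prod_topology (mtop M) (mtop S)) (mtop S) (\<lambda>(g, u). \<phi> g u)"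
    using action unfolding smooth_transitive_action_def smooth_map_def prod_manifold_def by simp
  then have "openin (prod_topology (mtop M) (mtop S)) ?Y"
    by (rule openin_continuous_map_preimage) (rule openin_Finv[OF open_ball])
  ultimately have "(\<one>, \<eta>) \<in> ?Y" and "openin (prod_topology (mtop M) (mtop S)) ?Y"
    using base one_closed carrier_eq by simp_all
  then obtain N B where NB: "openin (mtop M) N" "openin (mtop S) B" "\<one> \<in> N" "\<eta> \<in> B" "N \<times> B \<subseteq> ?Y"
    unfolding openin_prod_topology_alt by meson
  have "openin (top_of_set V) {Q \<in> V. F Q \<in> B}"
    using openin_continuous_map_preimage[OF F_bij(3) NB(2)] by simp
  then have "openin (top_of_set p) {Q \<in> V. F Q \<in> B}" using V_open openin_trans by blast
  then obtain r' where r': "r' > 0" "\<And>Q. Q \<in> p \<Longrightarrow> norm Q < r' \<Longrightarrow> Q \<in> V \<and> F Q \<in> B"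
    using ball_subset[of "{Q \<in> V. F Q \<in> B}"] V_zero F0 NB(4) by (auto simp: mem_Collect_eq)
  have "A g Q \<in> V" if g: "g \<in> N" "g \<in> K" and Q: "Q \<in> p" "norm Q < r'" for g Q
  proof -
    note gc = K_carrier[OF g(2)]
    have "norm (A g Q) < r / 2"
    proof (rule ccontr)
      assume "\<not> norm (A g Q) < r / 2"
      then have n: "norm (A g Q) \<ge> r / 2" by simp
      then have n0: "norm (A g Q) > 0" using r(1) by linarith
      define t where "t = (r / 2) / norm (A g Q)"
      have t: "0 < t" "t \<le> 1" "norm (t *\<^sub>R A g Q) = r / 2"
        using n n0 r(1) by (auto simp: t_def field_simps)
      have tA: "t *\<^sub>R A g Q \<in> V"
        using r t(3) p_scale[OF Ad_p[OF g(2) Q(1)]] by simp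
      \<comment> \<open>Since t is at most 1, the box N x B chosen for \<open>Q\<close> also serves
        t Q.\<close>
      have "norm (t *\<^sub>R Q) \<le> norm Q" using t by (simp add: mult_left_le_one_le)
      then have "F (t *\<^sub>R Q) \<in> B" using r'(2) p_scale Q by simp
      then have "\<phi> g (F (t *\<^sub>R Q)) \<in> ?W"
        using subsetD[OF NB(5), of "(g, F (t *\<^sub>R Q))"] g(1) by simp
      then have "norm (Finv (F (t *\<^sub>R A g Q))) < r / 2"
        using F_Ad[OF g(2) p_scale[OF Q(1)], of t] Ad_scale[OF gc Q(1)] by simp
      then show False using the_inv_into_f_f[OF F_bij(1) tA] t(3) by simp
    qed
    then show ?thesis using r Ad_p[OF g(2) Q(1)] by simp
  qed
  then show ?thesis using that NB(1,3) r' by blast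
qed

text \<open>Inverting \<open>F\<close> at g F(P) yields Ad_g P only once Ad_g P is known to be in
  \<open>V\<close>. For the small multiple Q = s P this is \<open>Ad_small\<close>; then Ad_g Q =
  Finv(g F(Q)) is continuous in g near the identity of the stabilizer, and dividing by s returns to
  P.\<close>

lemma Ad_near_one:
  assumes P: "P \<in> V"
  obtains N where "openin (mtop M) N" "\<one> \<in> N" "\<And>g. g \<in> N \<Longrightarrow> g \<in> K \<Longrightarrow> A g P \<in> V"
proof -
  obtain N r where N: "openin (mtop M) N" "\<one> \<in> N" and r: "r > 0" "\<And>Q. Q \<in> p \<Longrightarrow> norm Q < r \<Longrightarrow> Q \<in> V"
    and small: "\<And>g Q. g \<in> N \<Longrightarrow> g \<in> K \<Longrightarrow> Q \<in> p \<Longrightarrow> norm Q < r \<Longrightarrow> A g Q \<in> V"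
    using Ad_small by blast
  \<comment> \<open>Membership of Ad_g P in p comes from \<open>Ad_p\<close>, so only the open
    condition \<open>T\<close> has to be preserved by continuity.\<close>
  obtain T where T: "open T" "V = p \<inter> T" using V_open openin_open by blast
  have Pp: "P \<in> p" using P V_subset by blast
  \<comment> \<open>The summand 1 makes the norm of s P strictly less than r and covers P =
    0.\<close>
  define s where "s = r / (norm P + 1)"
  have s: "s > 0" using r(1) by (simp add: s_def add_nonneg_pos)
  define Q where "Q = s *\<^sub>R P"
  have "norm Q = r * (norm P / (norm P + 1))" using r(1) by (simp add: Q_def s_def add_nonneg_pos)
  also have "\<dots> < r * 1" using r(1) by (intro mult_strict_left_mono) (simp_all add: add_nonneg_pos)
  finally have Q: "Q \<in> p" "norm Q < r" using p_scale[OF Pp] by (simp_all add: Q_def)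
  have QV: "Q \<in> V" using r(2) Q by blast
  let ?T = "{q \<in> U. (1 / s) *\<^sub>R Finv q \<in> T}"
  let ?N = "N \<inter> {g \<in> topspace (mtop M). \<phi> g (F Q) \<in> ?T}"
  have "continuous_map (prod_topology (mtop M) (mtop S)) (mtop S) (\<lambda>(g, u). \<phi> g u)"
    using action unfolding smooth_transitive_action_def smooth_map_def prod_manifold_def by simp
  moreover have "continuous_map (mtop M) (prod_topology (mtop M) (mtop S)) (\<lambda>g. (g, F Q))"
    using F_topspace[OF Q(1)] by (simp add: continuous_map_pairedI)
  ultimately have "continuous_map (mtop M) (mtop S) (\<lambda>g. \<phi> g (F Q))"
    using continuous_map_compose[of "mtop M" _ "\<lambda>g. (g, F Q)"] by (fastforce simp: o_def)
  then have "openin (mtop M) {g \<in> topspace (mtop M). \<phi> g (F Q) \<in> ?T}"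
    by (rule openin_continuous_map_preimage[OF _ openin_Finv[OF T(1)]])
  then have "openin (mtop M) ?N" using N(1) by (rule openin_Int[rotated])
  moreover have "\<one> \<in> ?N"
  proof -
    have "\<phi> \<one> (F Q) = F Q" using id_eq_one F_topspace[OF Q(1)] by (metis restrict_apply')
    moreover have "F Q \<in> U" using QV F_bij(2) by blast
    moreover have "(1 / s) *\<^sub>R Finv (F Q) \<in> T"
      using the_inv_into_f_f[OF F_bij(1) QV] s P T by (simp add: Q_def)
    ultimately show ?thesis using N(2) one_closed carrier_eq by simp
  qed
  moreover have "A g P \<in> V" if g: "g \<in> ?N" "g \<in> K" for g
  proof -
    have "Finv (\<phi> g (F Q)) = A g Q"
      using the_inv_into_f_f[OF F_bij(1) small] g Q F_Ad by simp
    then have "A g P \<in> T" using g(1) s Ad_scale[OF K_carrier[OF g(2)] Pp] by (simp add: Q_def)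
    then show ?thesis using T Ad_p g(2) Pp by blast
  qed
  ultimately show ?thesis using that by blast
qed

end

section \<open>Equivariance of the interpolant\<close>

theorem proposition3p1:
  fixes G :: "'g monoid"
    and M :: "('g, 'e::{banach, heine_borel}) manifold"
    and c :: "('g, 'e) chart"
    and \<sigma> :: "'g \<Rightarrow> 'g"
    and S :: "('s, 'f::{banach, heine_borel}) manifold"
    and \<phi> :: "'g \<Rightarrow> 's \<Rightarrow> 's" and \<eta> :: 's
    and V :: "'e set" and U :: "'s set"
    and \<Omega> :: "(real ^ 'd) set" and pts :: "'m::finite \<Rightarrow> real ^ 'd"
    and I :: "('m \<Rightarrow> 'e) \<Rightarrow> real ^ 'd \<Rightarrow> 'e"
    and u :: "real ^ 'd \<Rightarrow> 's"
  defines "p \<equiv> minus_eigenspace G c \<sigma>"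
    and "F \<equiv> exp_orbit G M c \<phi> \<eta>"
  assumes "lie_group G M"
    and "c \<in> atlas M" and "\<one>\<^bsub>G\<^esub> \<in> fst c"
    and "involutive_automorphism G M \<sigma>"
    and "smooth_manifold S"
    and "smooth_transitive_action G M S \<phi>"
    and "\<eta> \<in> topspace (mtop S)"
    and "stabilizer G \<phi> \<eta> = fixed_subgroup G \<sigma>"
    and "openin (top_of_set p) V" and "0 \<in> V"
    and "openin (mtop S) U" and "\<eta> \<in> U"
    and "diffeomorphism (flat V) (open_submanifold S U) F"
    and "open \<Omega>" and "connected \<Omega>" and "range pts \<subseteq> \<Omega>"
    and "interpolation_operator \<Omega> pts p I"
    and "smooth_map (flat \<Omega>) S u" and "u ` \<Omega> \<subseteq> U"
    and "\<And>g P x. g \<in> fixed_subgroup G \<sigma> \<Longrightarrow> range P \<subseteq> p \<Longrightarrow> x \<in> \<Omega> \<Longrightarrow>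
           I (\<lambda>i. Ad G M c g (P i)) x = Ad G M c g (I P x)"
  shows "\<exists>N. openin (subtopology (mtop M) (fixed_subgroup G \<sigma>)) N \<and> \<one>\<^bsub>G\<^esub> \<in> N \<and>
           (\<forall>g\<in>N. (\<forall>i. \<phi> g (u (pts i)) \<in> U) \<and>
              (\<forall>x\<in>\<Omega>. interpolant F V pts I (\<lambda>y. \<phi> g (u y)) x =
                       \<phi> g (interpolant F V pts I u x)))"
proof -
  obtain D x where c: "c = (D, x)" by (cases c)
  interpret G: group G using assms(3) by (simp add: lie_group_def)
  interpret sp: symmetric_space_chart G M D x \<sigma> S \<phi> \<eta> V U
    using assms(3-15) unfolding c p_def F_def by unfold_locales simp_all
  have pF: "p = minus_eigenspace G (D, x) \<sigma>" "F = exp_orbit G M (D, x) \<phi> \<eta>"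
    unfolding p_def F_def c by auto
  define P where "P i = the_inv_into V F (u (pts i))" for i
  have uU: "u (pts i) \<in> U" for i using assms by blast
  have PV: "P i \<in> V" and FP: "F (P i) = u (pts i)" for i
    using the_inv_into_into[OF sp.F_bij(1), of "u (pts i)" V] f_the_inv_into_f[OF sp.F_bij(1), of "u (pts i)"]
      uU[of i] sp.F_bij(2) unfolding P_def pF by auto
  have "\<forall>i. \<exists>N. openin (mtop M) N \<and> \<one>\<^bsub>G\<^esub> \<in> N \<and>
      (\<forall>g\<in>N. g \<in> fixed_subgroup G \<sigma> \<longrightarrow> Ad G M c g (P i) \<in> V)"
    using sp.Ad_near_one[OF PV] unfolding c by metis
  then obtain N where N: "\<And>i. openin (mtop M) (N i)" "\<And>i. \<one>\<^bsub>G\<^esub> \<in> N i"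
    "\<And>i g. g \<in> N i \<Longrightarrow> g \<in> fixed_subgroup G \<sigma> \<Longrightarrow> Ad G M c g (P i) \<in> V"
    by metis
  \<comment> \<open>One neighbourhood for each node; the intersection stays open because the index
    type is finite.\<close>
  let ?N = "(\<Inter>i. N i) \<inter> fixed_subgroup G \<sigma>"
  have "openin (mtop M) (\<Inter>i. N i)" using N(1) by (intro openin_INT2) auto
  then have N_open: "openin (subtopology (mtop M) (fixed_subgroup G \<sigma>)) ?N"
    using openin_subtopology by blast
  have one_N: "\<one>\<^bsub>G\<^esub> \<in> ?N"
  proof -
    have "\<sigma> \<one>\<^bsub>G\<^esub> = \<one>\<^bsub>G\<^esub>"
      using assms(6) G.is_group hom_one unfolding involutive_automorphism_def by blast
    then show ?thesis using N(2) unfolding fixed_subgroup_def by simp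
  qed
  have equivariant: "(\<forall>i. \<phi> g (u (pts i)) \<in> U) \<and>
      (\<forall>y\<in>\<Omega>. interpolant F V pts I (\<lambda>y. \<phi> g (u y)) y = \<phi> g (interpolant F V pts I u y))"
    if g: "g \<in> ?N" for g
  proof (intro conjI allI ballI)
    have gK: "g \<in> fixed_subgroup G \<sigma>" using g by simp
    then have AV: "Ad G M c g (P i) \<in> V" for i using g N(3) by blast
    have Pp: "range P \<subseteq> p" using PV sp.V_subset unfolding pF by auto
    have FA: "F (Ad G M c g Q) = \<phi> g (F Q)" if "Q \<in> p" for Q
      using sp.F_Ad[OF gK] that unfolding pF c by blast
    have gu: "F (Ad G M c g (P i)) = \<phi> g (u (pts i))" for i
      using FA[of "P i"] Pp FP by auto
    show "\<phi> g (u (pts i)) \<in> U" for i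
      using gu[of i] AV[of i] sp.F_bij(2) unfolding pF by (metis imageI)
    have inv: "the_inv_into V F (\<phi> g (u (pts i))) = Ad G M c g (P i)" for i
      using the_inv_into_f_f[OF sp.F_bij(1) AV] gu unfolding pF by metis
    fix y assume y: "y \<in> \<Omega>"
    \<comment> \<open>The interpolated value lies in p but possibly outside \<open>V\<close>;
      \<open>FA\<close> holds on all of p, and \<open>F\<close> is inverted at the nodes
      only.\<close>
    then have "I P y \<in> p" using assms(19) Pp unfolding interpolation_operator_def by blast
    moreover have "I (\<lambda>i. Ad G M c g (P i)) y = Ad G M c g (I P y)"
      using assms(22) gK Pp y by blast
    ultimately show "interpolant F V pts I (\<lambda>y. \<phi> g (u y)) y = \<phi> g (interpolant F V pts I u y)"
      unfolding interpolant_def inv using FA by (simp add: P_def[abs_def])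
  qed
  show ?thesis
    by (rule exI[of _ ?N], rule conjI[OF N_open conjI[OF one_N ballI]]) (rule equivariant)
qed

end
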